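(* Let $G\in\Omega(\bar q)$ and let $Q(G)=\{\hat q\in\mathcal F_G:\ \mathcal V(G)=S(\hat q)-S(\bar q)\}$ be the solution set of the maximization problem defining the exchange value. (1) $Q(G)$ is a compact nonempty set. (2) If for each $j=1,\dots,\ell$ the function $u_j:\mathbb{R}_+^k\to\mathbb{R}$ is homogeneous of degree $\beta_j>0$ and $(u_j(q_j))^{1/\beta_j}$ is concave in $q_j$, then $Q(G)$ is convex. (3) If for each $j=1,\dots,\ell$ the function $u_j:\mathbb{R}_+^k\to\mathbb{R}$ is homogeneous of degree $\beta_j>0$ and $(u_j(q_j))^{1/\beta_j}$ is concave in $q_j$ and satisfies $$\big(u_j((1-\lambda_j)\tilde q_j+\lambda_j\hat q_j)\big)^{1/\beta_j}>(1-\lambda_j)\,(u_j(\tilde q_j))^{1/\beta_j}+\lambda_j\,(u_j(\hat q_j))^{1/\beta_j}$$ for each $\lambda_j\in(0,1)$ and any non-collinear $\tilde q_j,\hat q_j\in\mathbb{R}_+^k$, then $Q(G)$ is a singleton; that is, the problem of maximizing $S(q)-S(\bar q)$ over $q\in\mathcal F_G$ has a unique solution.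
   Context: Notation: $\mathbb{R}_+^k$ and $\mathbb{R}_{++}^k$ are the vectors in $\mathbb{R}^k$ with all coordinates $\ge 0$, respectively $>0$. Economy. $X\subset\mathbb{R}^m$ is compact and convex. There are $k$ goods, good $i$ being supplied at a point $x_i\in X$, and $\ell$ consumers, consumer $j$ being located at $y_j\in X$ (all these points distinct). Consumer $j$ has a utility function $u_j:\mathbb{R}_+^k\to\mathbb{R}$ that is continuous, concave and increasing ($u_j(q')>u_j(q)$ whenever $q'_i>q_i$ for all $i$), a wealth $w_j>0$ and a price vector $p_j=(p_{1j},\dots,p_{kj})\in\mathbb{R}_{++}^k$. Fix for each $j$ a maximizer $\bar q_j=(\bar q_{1j},\dots,\bar q_{kj})$ of $u_j(q_j)$ over $\{q_j\in\mathbb{R}_+^k: p_j\cdot q_j\le w_j\}$, and let $\bar q=(\bar q_{ij})_{k\times\ell}$, normalized so that $\sum_{i,j}\bar q_{ij}=1$. Put $m_i=\sum_j\bar q_{ij}$, $n_j=\sum_i\bar q_{ij}$ (all positive), $\mathbf a=\sum_i m_i\delta_{x_i}$, $\mathbf b=\sum_j n_j\delta_{y_j}$. $\mathcal P(X\times X)$ denotes probability measures $q=\sum_{i,j}q_{ij}\delta_{(x_i,y_j)}$, identified with nonnegative $k\times\ell$ matrices of total sum 1; $q_j=(q_{1j},\dots,q_{kj})$ is the $j$-th column. Transport paths. A transport path $G$ from $\mathbf a$ to $\mathbf b$ is a finite weighted directed graph with vertex set $V(G)\subset X$ containing all $x_i,y_j$, directed edges $e\in E(G)$ which are line segments from $e^-$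 to $e^+$, and weights $w(e)>0$, such that for every vertex $v$, $\sum_{e^-=v}w(e)=\sum_{e^+=v}w(e)+c_v$, where $c_v=m_i$ if $v=x_i$, $c_v=-n_j$ if $v=y_j$, and $c_v=0$ otherwise. It is assumed that for each $(i,j)$ there is at most one directed curve $g_{ij}$ from $x_i$ to $y_j$ in $G$, i.e. at most one list of distinct vertices starting at $x_i$ and ending at $y_j$ whose consecutive members are joined by directed edges of $G$; $e\subseteq g_{ij}$ means that the edge $e$ lies on this curve. A matrix $q\in\mathcal P(X\times X)$ is compatible with $G$ if $q_{ij}=0$ whenever $g_{ij}$ does not exist and $\sum_{(i,j):e\subseteq g_{ij}}q_{ij}=w(e)$ for every $e\in E(G)$. $\Omega(\bar q)$ is the set of transport paths $G$ from $\mathbf a$ to $\mathbf b$ with which $\bar q$ is compatible. Exchange value. $S(q)=\sum_{j=1}^\ell\min\{p_j\cdot t_j: t_j\in\mathbb{R}_+^k,\ u_j(t_j)\ge u_j(q_j)\}$. For $G\in\Omega(\bar q)$, $\mathcal F_G$ is the set of $q\in\mathcal P(X\times X)$ compatible with $G$ with $u_j(q_j)\ge u_j(\bar q_j)$ for all $j$, and $\mathcal V(G)=\max_{q\in\mathcal F_G}S(q)-S(\bar q)$. *)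

theory Defs
  imports
    "HOL-Analysis.Analysis"
    "Graph_Theory.Pair_Digraph"
    "Graph_Theory.Vertex_Walk"
begin

section \<open>Economy\<close>

text \<open>
  Goods are indexed by the finite type \<open>'k\<close> and consumers by the finite type \<open>'l\<close>.
  A commodity bundle is a vector \<open>real ^ 'k\<close>; a \<open>k \<times> l\<close> matrix is \<open>real ^ 'l ^ 'k\<close>,
  so that \<open>q $ i $ j\<close> is $q_{ij}$ and \<open>column j q\<close> is $q_j$.
\<close>

definition orthant :: "(real ^ 'k) set" where
  "orthant = {t. \<forall>i. 0 \<le> t $ i}"

definition utility :: "(real ^ 'k \<Rightarrow> real) \<Rightarrow> bool" where
  "utility f \<longleftrightarrow>
     continuous_on orthant f \<and> concave_on orthant f \<and>
     (\<forall>t\<in>orthant. \<forall>t'\<in>orthant. (\<forall>i. t' $ i > t $ i) \<longrightarrow> f t' > f t)"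

definition budget_set :: "real ^ 'k \<Rightarrow> real \<Rightarrow> (real ^ 'k) set" where
  "budget_set price wealth = {t \<in> orthant. price \<bullet> t \<le> wealth}"

text \<open>
  Probability measures $\sum_{i,j} q_{ij}\,\delta_{(x_i,y_j)}$, identified with their matrices.
\<close>

definition plans :: "(real ^ 'l ^ 'k) set" where
  "plans = {q. (\<forall>i j. 0 \<le> q $ i $ j) \<and> (\<Sum>i\<in>UNIV. \<Sum>j\<in>UNIV. q $ i $ j) = 1}"

definition total_supply :: "real ^ 'l ^ 'k \<Rightarrow> 'k \<Rightarrow> real" where
  "total_supply q i = (\<Sum>j\<in>UNIV. q $ i $ j)"

definition total_demand :: "real ^ 'l ^ 'k \<Rightarrow> 'l \<Rightarrow> real" where
  "total_demand q j = (\<Sum>i\<in>UNIV. q $ i $ j)"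


section \<open>Transport paths\<close>

text \<open>
  An edge is a directed line segment, hence determined by the ordered pair of its
  (distinct) end points. Values of \<open>weight\<close> off the edge set are irrelevant.
\<close>

record 'v weighted_digraph =
  network :: "'v pair_pre_digraph"
  weight :: "'v \<times> 'v \<Rightarrow> real"

definition curves :: "'v weighted_digraph \<Rightarrow> 'v \<Rightarrow> 'v \<Rightarrow> 'v list set" where
  "curves G s t = {c. vpath c (with_proj (network G)) \<and> hd c = s \<and> last c = t}"

definition outflow :: "'v weighted_digraph \<Rightarrow> 'v \<Rightarrow> real" where
  "outflow G v = (\<Sum>e | e \<in> parcs (network G) \<and> fst e = v. weight G e)"

definition inflow :: "'v weighted_digraph \<Rightarrow> 'v \<Rightarrow> real" where
  "inflow G v = (\<Sum>e | e \<in> parcs (network G) \<and> snd e = v. weight G e)"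

text \<open>
  Transport paths from $\sum_i m_i\,\delta_{x_i}$ to $\sum_j n_j\,\delta_{y_j}$, including the
  standing assumption that there is at most one directed curve from each $x_i$ to each $y_j$.
\<close>

definition transport_path ::
  "(real ^ 'm) set \<Rightarrow> ('k \<Rightarrow> real ^ 'm) \<Rightarrow> ('l \<Rightarrow> real ^ 'm) \<Rightarrow> ('k \<Rightarrow> real) \<Rightarrow> ('l \<Rightarrow> real)
    \<Rightarrow> (real ^ 'm) weighted_digraph \<Rightarrow> bool" where
  "transport_path X x y m n G \<longleftrightarrow>
     pair_digraph (network G) \<and>
     pverts (network G) \<subseteq> X \<and>
     range x \<union> range y \<subseteq> pverts (network G) \<and>
     (\<forall>e \<in> parcs (network G). weight G e > 0) \<and>
     (\<forall>i. outflow G (x i) = inflow G (x i) + m i) \<and>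
     (\<forall>j. outflow G (y j) = inflow G (y j) - n j) \<and>
     (\<forall>v \<in> pverts (network G) - (range x \<union> range y). outflow G v = inflow G v) \<and>
     (\<forall>i j. \<exists>\<^sub>\<le>\<^sub>1 c. c \<in> curves G (x i) (y j))"

definition edge_on_curve :: "'v weighted_digraph \<Rightarrow> 'v \<times> 'v \<Rightarrow> 'v \<Rightarrow> 'v \<Rightarrow> bool" where
  "edge_on_curve G e s t \<longleftrightarrow> (\<exists>c \<in> curves G s t. e \<in> set (vwalk_arcs c))"

definition compatible ::
  "('k \<Rightarrow> 'v) \<Rightarrow> ('l \<Rightarrow> 'v) \<Rightarrow> 'v weighted_digraph \<Rightarrow> real ^ 'l ^ 'k \<Rightarrow> bool" where
  "compatible x y G q \<longleftrightarrow>
     (\<forall>i j. curves G (x i) (y j) = {} \<longrightarrow> q $ i $ j = 0) \<and>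
     (\<forall>e \<in> parcs (network G).
        (\<Sum>(i, j) | edge_on_curve G e (x i) (y j). q $ i $ j) = weight G e)"

definition Omega ::
  "(real ^ 'm) set \<Rightarrow> ('k \<Rightarrow> real ^ 'm) \<Rightarrow> ('l \<Rightarrow> real ^ 'm) \<Rightarrow> real ^ 'l ^ 'k
    \<Rightarrow> (real ^ 'm) weighted_digraph set" where
  "Omega X x y qbar =
     {G. transport_path X x y (total_supply qbar) (total_demand qbar) G \<and> compatible x y G qbar}"


section \<open>Exchange value\<close>

definition expenditure :: "(real ^ 'k \<Rightarrow> real) \<Rightarrow> real ^ 'k \<Rightarrow> real \<Rightarrow> real" where
  "expenditure f price r = (LEAST c. \<exists>t \<in> orthant. f t \<ge> r \<and> c = price \<bullet> t)"

definition S_total ::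
  "('l \<Rightarrow> real ^ 'k \<Rightarrow> real) \<Rightarrow> ('l \<Rightarrow> real ^ 'k) \<Rightarrow> real ^ 'l ^ 'k \<Rightarrow> real" where
  "S_total u p q = (\<Sum>j\<in>UNIV. expenditure (u j) (p j) (u j (column j q)))"

definition feasible_plans ::
  "('k \<Rightarrow> 'v) \<Rightarrow> ('l \<Rightarrow> 'v) \<Rightarrow> ('l \<Rightarrow> real ^ 'k \<Rightarrow> real) \<Rightarrow> real ^ 'l ^ 'k
    \<Rightarrow> 'v weighted_digraph \<Rightarrow> (real ^ 'l ^ 'k) set" where
  "feasible_plans x y u qbar G =
     {q \<in> plans. compatible x y G q \<and> (\<forall>j. u j (column j q) \<ge> u j (column j qbar))}"

definition exchange_value ::
  "('k \<Rightarrow> 'v) \<Rightarrow> ('l \<Rightarrow> 'v) \<Rightarrow> ('l \<Rightarrow> real ^ 'k \<Rightarrow> real) \<Rightarrow> ('l \<Rightarrow> real ^ 'k) \<Rightarrow> real ^ 'l ^ 'k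
    \<Rightarrow> 'v weighted_digraph \<Rightarrow> real" where
  "exchange_value x y u p qbar G =
     (GREATEST s. \<exists>q \<in> feasible_plans x y u qbar G. s = S_total u p q) - S_total u p qbar"

definition solution_set ::
  "('k \<Rightarrow> 'v) \<Rightarrow> ('l \<Rightarrow> 'v) \<Rightarrow> ('l \<Rightarrow> real ^ 'k \<Rightarrow> real) \<Rightarrow> ('l \<Rightarrow> real ^ 'k) \<Rightarrow> real ^ 'l ^ 'k
    \<Rightarrow> 'v weighted_digraph \<Rightarrow> (real ^ 'l ^ 'k) set" where
  "solution_set x y u p qbar G =
     {qhat \<in> feasible_plans x y u qbar G.
        exchange_value x y u p qbar G = S_total u p qhat - S_total u p qbar}"


section \<open>Homogeneous utilities\<close>

definition homogeneous :: "real \<Rightarrow> (real ^ 'k \<Rightarrow> real) \<Rightarrow> bool" where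
  "homogeneous \<beta> f \<longleftrightarrow> (\<forall>t\<in>orthant. \<forall>r>0. f (r *\<^sub>R t) = r powr \<beta> * f t)"

text \<open>
  A homogeneous utility vanishes at the origin and is therefore nonnegative on the orthant,
  so the real power $f(t)^{1/\beta}$ below has its usual meaning.
\<close>

definition homogeneous_root_concave :: "real \<Rightarrow> (real ^ 'k \<Rightarrow> real) \<Rightarrow> bool" where
  "homogeneous_root_concave \<beta> f \<longleftrightarrow>
     \<beta> > 0 \<and> homogeneous \<beta> f \<and> concave_on orthant (\<lambda>t. f t powr (1 / \<beta>))"

text \<open>
  Two bundles are collinear when they lie on a common line through the origin
  (any two points lie on some affine line).
\<close>

definition root_strict_on_noncollinear :: "real \<Rightarrow> (real ^ 'k \<Rightarrow> real) \<Rightarrow> bool" where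
  "root_strict_on_noncollinear \<beta> f \<longleftrightarrow>
     (\<forall>s\<in>orthant. \<forall>t\<in>orthant. \<forall>r. 0 < r \<and> r < 1 \<and> \<not> collinear {0, s, t} \<longrightarrow>
        f ((1 - r) *\<^sub>R s + r *\<^sub>R t) powr (1 / \<beta>)
          > (1 - r) * f s powr (1 / \<beta>) + r * f t powr (1 / \<beta>))"

end

theory Submission
  imports Defs
begin

text \<open>
  The map sending a bundle $t$ to the least expenditure that reaches its utility is continuous,
  so part (1) is the extreme value theorem on the compact set of feasible plans.
  For a utility $f$ homogeneous of degree $\beta$ the least expenditure equals $C f(t)^{1/\beta}$
  with $C > 0$, hence the exchange value is concave and part (2) follows.
  For part (3), the midpoint of two maximizers is strictly better unless their columns are
  pairwise collinear. Compatibility with $G$ fixes the column sums: for any function $h$ on the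
  vertices, $\sum_e w(e)\,(h(e^+) - h(e^-))$ telescopes along the curves to
  $\sum_{i,j} q_{ij}\,(h(y_j) - h(x_i))$, and $h$ the indicator of $y_j$ yields $n_j$.
  Collinear columns with equal positive sums coincide.
\<close>

section \<open>Column sums of compatible plans\<close>

lemma arc_endpoints_in_vwalk:
  "e \<in> set (vwalk_arcs c) \<Longrightarrow> fst e \<in> set c \<and> snd e \<in> set c"
  by (induct c rule: vwalk_arcs.induct) auto

text \<open>A telescoping sum. It runs over the set of arcs, so distinctness of the vertices is what
  keeps an arc from being traversed twice and counted once.\<close>

lemma sum_vwalk_arcs_telescope:
  fixes h :: "'v \<Rightarrow> real"
  assumes "distinct c" "c \<noteq> []"
  shows "(\<Sum>e\<in>set (vwalk_arcs c). h (snd e) - h (fst e)) = h (last c) - h (hd c)"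
  using assms
proof (induct c rule: vwalk_arcs.induct)
  case (3 a b c)
  \<comment> \<open>The vertex \<open>a\<close> does not recur in \<open>b # c\<close>, so inserting
    the first arc into the arc set really adds a term.\<close>
  have "(a, b) \<notin> set (vwalk_arcs (b # c))"
    using 3(2) arc_endpoints_in_vwalk[of "(a, b)" "b # c"] by auto
  then show ?case using 3 by simp
qed auto

text \<open>Compatibility replaces each weight by the plan entries whose curve uses that edge. After
  exchanging the two sums, the inner sum runs along a single curve and telescopes.\<close>

lemma compatible_sum_weight_telescope:
  fixes h :: "'v \<Rightarrow> real" and q :: "real ^ 'l::finite ^ 'k::finite"
  assumes wf: "pair_digraph (network G)"
    and uniq: "\<forall>i j. \<exists>\<^sub>\<le>\<^sub>1 c. c \<in> curves G (x i) (y j)"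
    and q: "compatible x y G q"
  shows "(\<Sum>e\<in>parcs (network G). weight G e * (h (snd e) - h (fst e)))
       = (\<Sum>i\<in>UNIV. \<Sum>j\<in>UNIV. q $ i $ j * (h (y j) - h (x i)))"
proof -
  let ?E = "parcs (network G)" and ?d = "\<lambda>e. h (snd e) - h (fst e)"
  let ?on = "\<lambda>e ij. edge_on_curve G e (x (fst ij)) (y (snd ij))"
  have fin: "finite ?E"
    using wf by (auto simp: pair_digraph_def pair_fin_digraph_def pair_fin_digraph_axioms_def)
  have w: "weight G e = (\<Sum>ij | ?on e ij. q $ fst ij $ snd ij)" if "e \<in> ?E" for e
    using q that unfolding compatible_def by (auto simp: case_prod_unfold)
  \<comment> \<open>The factor \<open>q $ i $ j\<close> covers the pairs without a curve, where
    compatibility makes both sides zero. Otherwise the curve is unique, so the edges selected by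
    \<open>?on\<close> are exactly its arcs.\<close>
  have curve: "q $ i $ j * (\<Sum>e | e \<in> ?E \<and> ?on e (i, j). ?d e) = q $ i $ j * (h (y j) - h (x i))"
    for i j
  proof (cases "curves G (x i) (y j) = {}")
    case True
    then show ?thesis using q by (simp add: compatible_def)
  next
    case False
    then obtain c where c: "c \<in> curves G (x i) (y j)" by blast
    with uniq have "curves G (x i) (y j) = {c}"
      unfolding Uniq_def by blast
    then have on: "?on e (i, j) \<longleftrightarrow> e \<in> set (vwalk_arcs c)" for e
      by (simp add: edge_on_curve_def)
    have p: "distinct c" "c \<noteq> []" "hd c = x i" "last c = y j" "set (vwalk_arcs c) \<subseteq> ?E"
      using c by (auto simp: curves_def vpath_def vwalk_def arcs_ends_def arc_to_ends_def)
    have "{e \<in> ?E. ?on e (i, j)} = set (vwalk_arcs c)"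
      using p on by auto
    then show ?thesis
      using sum_vwalk_arcs_telescope[OF p(1,2), of h] p(3,4) by simp
  qed
  have "(\<Sum>e\<in>?E. weight G e * ?d e) = (\<Sum>e\<in>?E. \<Sum>ij | ?on e ij. q $ fst ij $ snd ij * ?d e)"
    by (simp add: w sum_distrib_right)
  \<comment> \<open>The vacuous membership gives the inner sum the shape that
    \<open>sum.swap_restrict\<close> expects.\<close>
  also have "\<dots> = (\<Sum>e\<in>?E. \<Sum>ij | ij \<in> UNIV \<and> ?on e ij. q $ fst ij $ snd ij * ?d e)"
    by simp
  also have "\<dots> = (\<Sum>ij\<in>UNIV. \<Sum>e | e \<in> ?E \<and> ?on e ij. q $ fst ij $ snd ij * ?d e)"
    by (rule sum.swap_restrict) (use fin in auto)
  also have "\<dots> = (\<Sum>ij\<in>UNIV. q $ fst ij $ snd ij * (h (y (snd ij)) - h (x (fst ij))))"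
    using curve by (intro sum.cong refl) (auto simp: sum_distrib_left[symmetric])
  also have "\<dots> = (\<Sum>i\<in>UNIV. \<Sum>j\<in>UNIV. q $ i $ j * (h (y j) - h (x i)))"
    by (simp add: sum.cartesian_product case_prod_unfold flip: UNIV_Times_UNIV)
  finally show ?thesis .
qed

text \<open>The edge side of the telescoping identity does not mention the plan, so the other side
  agrees for all compatible plans.\<close>

lemma compatible_total_demand_eq:
  fixes q q' :: "real ^ 'l::finite ^ 'k::finite"
  assumes wf: "pair_digraph (network G)"
    and uniq: "\<forall>i j. \<exists>\<^sub>\<le>\<^sub>1 c. c \<in> curves G (x i) (y j)"
    and "inj y" "range x \<inter> range y = {}"
    and "compatible x y G q" "compatible x y G q'"
  shows "total_demand q j = total_demand q' j"
proof -
  have *: "(\<Sum>e\<in>parcs (network G). weight G e * (of_bool (snd e = y j) - of_bool (fst e = y j)))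
      = total_demand r j" if "compatible x y G r" for r :: "real ^ 'l ^ 'k"
  proof -
    \<comment> \<open>Injectivity of \<open>y\<close> isolates column \<open>j\<close>; disjointness
      of the two ranges removes the contribution of the suppliers.\<close>
    have "r $ i $ j' * (of_bool (y j' = y j) - of_bool (x i = y j)) = (if j' = j then r $ i $ j' else 0)"
      for i j'
      using assms(3,4) by (auto simp: inj_eq)
    then show ?thesis
      using compatible_sum_weight_telescope[OF wf uniq that, of "\<lambda>v. of_bool (v = y j)"]
      by (simp add: total_demand_def)
  qed
  show ?thesis using *[OF assms(5)] *[OF assms(6)] by simp
qed

section \<open>The expenditure function\<close>

lemma closed_orthant: "closed (orthant :: (real ^ 'k::finite) set)"
  unfolding orthant_def by (intro closed_Collect_all closed_Collect_le continuous_intros)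

lemma orthant_scaleR: "t \<in> orthant \<Longrightarrow> 0 \<le> r \<Longrightarrow> r *\<^sub>R t \<in> orthant"
  by (simp add: orthant_def)

lemma zero_in_orthant: "0 \<in> orthant"
  by (simp add: orthant_def)

lemma orthant_add_scaleR_one: "t \<in> orthant \<Longrightarrow> 0 \<le> r \<Longrightarrow> t + r *\<^sub>R 1 \<in> orthant"
  by (simp add: orthant_def)

lemma inner_orthant_nonneg:
  fixes t :: "real ^ 'k::finite"
  shows "\<forall>i. p $ i > 0 \<Longrightarrow> t \<in> orthant \<Longrightarrow> 0 \<le> p \<bullet> t"
  by (auto simp: orthant_def inner_vec_def less_imp_le intro!: sum_nonneg mult_nonneg_nonneg)

lemma inner_orthant_pos:
  fixes t :: "real ^ 'k::finite"
  assumes p: "\<forall>i. p $ i > 0" and t: "t \<in> orthant" "t \<noteq> 0"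
  shows "0 < p \<bullet> t"
proof -
  obtain i where "t $ i \<noteq> 0" using t(2) by (auto simp: vec_eq_iff)
  then have "t $ i > 0" using t by (auto simp: orthant_def less_le)
  then have "0 < p $ i \<bullet> t $ i" using p by simp
  moreover have "\<forall>i. 0 \<le> p $ i \<bullet> t $ i"
    using p t(1) by (simp add: orthant_def less_imp_le)
  ultimately show ?thesis
    unfolding inner_vec_def by (intro sum_pos2[of _ i]) auto
qed

text \<open>Positive prices confine coordinate \<open>i\<close> of an affordable bundle to the
  interval from 0 to \<open>w / p $ i\<close>.\<close>

lemma compact_budget_set:
  fixes p :: "real ^ 'k::finite"
  assumes p: "\<forall>i. p $ i > 0"
  shows "compact (budget_set p w)"
proof -
  have "t \<in> cbox 0 (\<chi> i. w / p $ i)" if "t \<in> budget_set p w" for t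
  proof -
    have t: "t \<in> orthant" "p \<bullet> t \<le> w" using that by (auto simp: budget_set_def)
    have "t $ i \<le> w / p $ i" for i
    proof -
      have "p $ i * t $ i \<le> p \<bullet> t"
        unfolding inner_vec_def inner_real_def
        using p t(1) by (intro member_le_sum) (auto simp: orthant_def less_imp_le)
      with t(2) p show ?thesis by (simp add: field_simps)
    qed
    then show ?thesis using t by (simp add: mem_box_cart orthant_def)
  qed
  then have "bounded (budget_set p w)"
    by (meson bounded_cbox bounded_subset subsetI)
  moreover have "budget_set p w = orthant \<inter> {t. p \<bullet> t \<le> w}"
    by (auto simp: budget_set_def)
  then have "closed (budget_set p w)"
    by (auto intro!: closed_Int closed_orthant closed_Collect_le continuous_intros)
  ultimately show ?thesis by (simp add: compact_eq_bounded_closed)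
qed

text \<open>The bundles of utility at least \<open>r\<close> may form an unbounded set, but only
  those costing no more than \<open>t0\<close> compete for the minimum, and these form a compact
  set. This also gives the \<open>LEAST\<close> in \<open>expenditure\<close> its intended
  meaning.\<close>

lemma expenditure_attained:
  fixes f :: "real ^ 'k::finite \<Rightarrow> real"
  assumes f: "continuous_on orthant f" and p: "\<forall>i. p $ i > 0"
    and t0: "t0 \<in> orthant" "r \<le> f t0"
  obtains t where "t \<in> orthant" "r \<le> f t" "expenditure f p r = p \<bullet> t"
    "\<And>s. s \<in> orthant \<Longrightarrow> r \<le> f s \<Longrightarrow> p \<bullet> t \<le> p \<bullet> s"
proof -
  let ?K = "{t \<in> budget_set p (p \<bullet> t0). r \<le> f t}"
  have "continuous_on (budget_set p (p \<bullet> t0)) f"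
    using f by (rule continuous_on_subset) (auto simp: budget_set_def)
  then have "closed ?K"
    using compact_budget_set[OF p] by (intro continuous_on_closed_Collect_le continuous_intros)
      (auto simp: compact_imp_closed)
  then have "compact (budget_set p (p \<bullet> t0) \<inter> ?K)"
    using compact_budget_set[OF p] by (rule compact_Int_closed[rotated])
  moreover have "budget_set p (p \<bullet> t0) \<inter> ?K = ?K" by auto
  ultimately have "compact ?K" by simp
  moreover have "t0 \<in> ?K" using t0 by (simp add: budget_set_def)
  ultimately obtain t where t: "t \<in> ?K" "\<forall>s\<in>?K. p \<bullet> t \<le> p \<bullet> s"
    using continuous_attains_inf[of ?K "\<lambda>s. p \<bullet> s"] by (fastforce intro: continuous_intros)
  have min: "p \<bullet> t \<le> p \<bullet> s" if "s \<in> orthant" "r \<le> f s" for s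
    using t that by (cases "p \<bullet> s \<le> p \<bullet> t0") (auto simp: budget_set_def)
  have "expenditure f p r = p \<bullet> t"
    unfolding expenditure_def using t(1) min
    by (intro Least_equality) (auto simp: budget_set_def)
  with t(1) min show ?thesis by (intro that[of t]) (auto simp: budget_set_def)
qed

lemma expenditure_le:
  fixes f :: "real ^ 'k::finite \<Rightarrow> real"
  assumes "continuous_on orthant f" "\<forall>i. p $ i > 0" "s \<in> orthant" "r \<le> f s"
  shows "expenditure f p r \<le> p \<bullet> s"
  using expenditure_attained[OF assms] assms(3,4) by metis

text \<open>Lower semicontinuity comes from compactness of budget sets, upper semicontinuity from
  monotonicity of the utility; each is one half of the order characterisation of limits.\<close>

lemma continuous_on_expenditure_utility:
  fixes f :: "real ^ 'k::finite \<Rightarrow> real"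
  assumes u: "utility f" and p: "\<forall>i. p $ i > 0"
  shows "continuous_on orthant (\<lambda>t. expenditure f p (f t))"
proof -
  have f: "continuous_on orthant f"
    and inc: "\<And>t t'. t \<in> orthant \<Longrightarrow> t' \<in> orthant \<Longrightarrow> \<forall>i. t' $ i > t $ i \<Longrightarrow> f t' > f t"
    using u by (auto simp: utility_def)
  show ?thesis
    unfolding continuous_on
  proof (intro ballI order_tendstoI)
    fix t :: "real ^ 'k" and a
    assume t: "t \<in> orthant" and a: "a < expenditure f p (f t)"
    let ?F = "at t within orthant"
    have lim: "(f \<longlongrightarrow> f t) ?F" using f t by (simp add: continuous_on)
    have in_orth: "\<forall>\<^sub>F s in ?F. s \<in> orthant" by (simp add: eventually_at_filter)
    show "\<forall>\<^sub>F s in ?F. a < expenditure f p (f s)"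
    \<comment> \<open>If nothing is affordable at \<open>a\<close>, every cost-minimizing bundle
      costs more than \<open>a\<close>. The split is needed because the other case maximizes
      \<open>f\<close> over this budget set.\<close>
    proof (cases "budget_set p a = {}")
      case True
      have "a < expenditure f p (f s)" if s: "s \<in> orthant" for s
        by (rule expenditure_attained[OF f p s order_refl]) (use True in \<open>force simp: budget_set_def\<close>)
      with in_orth show ?thesis by (auto elim: eventually_mono)
    next
      case False
      have "continuous_on (budget_set p a) f"
        using f by (rule continuous_on_subset) (auto simp: budget_set_def)
      then obtain b where b: "b \<in> budget_set p a" "\<forall>s\<in>budget_set p a. f s \<le> f b"
        using continuous_attains_sup[OF compact_budget_set[OF p] False] by blast
      \<comment> \<open>Otherwise the best bundle affordable at \<open>a\<close> would reach utility
        \<open>f t\<close>, contradicting \<open>a < expenditure f p (f t)\<close>. Nearby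
        \<open>s\<close> then also have utility out of reach at cost \<open>a\<close>.\<close>
      have "f b < f t"
      proof (rule ccontr)
        assume "\<not> f b < f t"
        then have "expenditure f p (f t) \<le> p \<bullet> b"
          using b(1) by (intro expenditure_le f p) (auto simp: budget_set_def)
        with a b(1) show False by (simp add: budget_set_def)
      qed
      then have "\<forall>\<^sub>F s in ?F. f b < f s" by (rule order_tendstoD[OF lim])
      with in_orth show ?thesis
      proof eventually_elim
        case (elim s)
        obtain m where m: "m \<in> orthant" "f s \<le> f m" "expenditure f p (f s) = p \<bullet> m"
          using expenditure_attained[OF f p elim(1) order_refl] by metis
        with b(2) elim(2) have "m \<notin> budget_set p a" by force
        with m show ?case by (auto simp: budget_set_def)
      qed
    qed
  next
    fix t :: "real ^ 'k" and a
    assume t: "t \<in> orthant" and a: "expenditure f p (f t) < a"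
    let ?F = "at t within orthant"
    have lim: "(f \<longlongrightarrow> f t) ?F" using f t by (simp add: continuous_on)
    obtain m where m: "m \<in> orthant" "f t \<le> f m" "expenditure f p (f t) = p \<bullet> m"
      using expenditure_attained[OF f p t order_refl] by metis
    \<comment> \<open>Raising every coordinate of the minimizer \<open>m\<close> slightly keeps the
      cost below \<open>a\<close> but strictly increases utility, which leaves room for all
      \<open>f s\<close> with \<open>s\<close> near \<open>t\<close>.\<close>
    have "((\<lambda>r. p \<bullet> (m + r *\<^sub>R 1)) \<longlongrightarrow> p \<bullet> (m + 0 *\<^sub>R 1)) (at_right 0)"
      by (intro tendsto_intros)
    with a m(3) have "\<forall>\<^sub>F r in at_right 0. p \<bullet> (m + r *\<^sub>R 1) < a"
      by (intro order_tendstoD(2)) auto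
    moreover have "\<forall>\<^sub>F r in at_right (0::real). 0 < r"
      by (simp add: eventually_at_right_less)
    ultimately have "\<forall>\<^sub>F r in at_right (0::real). p \<bullet> (m + r *\<^sub>R 1) < a \<and> 0 < r"
      by eventually_elim simp
    then obtain r where r: "p \<bullet> (m + r *\<^sub>R 1) < a" "0 < r"
      using eventually_happens'[OF trivial_limit_at_right_real] by blast
    let ?m = "m + r *\<^sub>R 1"
    have m': "?m \<in> orthant" using m(1) r(2) by (simp add: orthant_add_scaleR_one)
    have "f m < f ?m" using m(1) m' r(2) by (intro inc) auto
    with m(2) have "\<forall>\<^sub>F s in ?F. f s < f ?m"
      by (intro order_tendstoD[OF lim]) simp
    then show "\<forall>\<^sub>F s in ?F. expenditure f p (f s) < a"
    proof eventually_elim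
      case (elim s)
      have "expenditure f p (f s) \<le> p \<bullet> ?m"
        using elim by (intro expenditure_le f p m') simp
      with r(1) show ?case by simp
    qed
  qed
qed

section \<open>Homogeneous utilities and their explicit expenditure\<close>

lemma homogeneous_utility_zero:
  fixes f :: "real ^ 'k::finite \<Rightarrow> real"
  assumes "homogeneous \<beta> f" "\<beta> > 0"
  shows "f 0 = 0"
proof -
  have "f (2 *\<^sub>R 0) = 2 powr \<beta> * f 0"
    using assms(1) zero_in_orthant unfolding homogeneous_def by (metis zero_less_numeral)
  moreover have "(2::real) powr \<beta> \<noteq> 1" using assms(2) by simp
  ultimately show ?thesis by simp
qed

text \<open>Monotonicity only compares bundles that differ strictly in every coordinate, so
  \<open>t\<close> is first shifted by a positive multiple of the all-ones vector; continuity then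
  recovers \<open>f t\<close>.\<close>

lemma homogeneous_utility_nonneg:
  fixes f :: "real ^ 'k::finite \<Rightarrow> real"
  assumes u: "utility f" and h: "homogeneous \<beta> f" "\<beta> > 0" and t: "t \<in> orthant"
  shows "0 \<le> f t"
proof -
  have f: "continuous_on orthant f"
    and inc: "\<And>t t'. t \<in> orthant \<Longrightarrow> t' \<in> orthant \<Longrightarrow> \<forall>i. t' $ i > t $ i \<Longrightarrow> f t' > f t"
    using u by (auto simp: utility_def)
  have "continuous_on {0::real..} (\<lambda>r. f (t + r *\<^sub>R 1))"
    using t by (intro continuous_on_compose2[OF f] continuous_intros) (auto simp: orthant_add_scaleR_one)
  then have "((\<lambda>r. f (t + r *\<^sub>R 1)) \<longlongrightarrow> f (t + 0 *\<^sub>R 1)) (at 0 within {0..})"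
    unfolding continuous_on by (rule bspec) simp
  then have "((\<lambda>r. f (t + r *\<^sub>R 1)) \<longlongrightarrow> f (t + 0 *\<^sub>R 1)) (at_right 0)"
    by (rule tendsto_within_subset) auto
  moreover have "0 < f (t + r *\<^sub>R 1)" if "0 < r" for r
    using inc[of 0 "t + r *\<^sub>R 1"] that t homogeneous_utility_zero[OF h]
    by (auto simp: orthant_def add_nonneg_pos)
  then have "\<forall>\<^sub>F r in at_right 0. 0 \<le> f (t + r *\<^sub>R 1)"
    by (auto simp: eventually_at_filter less_imp_le)
  ultimately show ?thesis
    using tendsto_lowerbound[OF _ _ trivial_limit_at_right_real] by fastforce
qed

text \<open>Scaling a bundle by \<open>c\<close> multiplies its cost by \<open>c\<close> and its
  utility by \<open>c powr \<beta>\<close>. Hence all positive utility levels reduce to level 1, and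
  the constant \<open>C\<close> is the least cost of reaching level 1.\<close>

lemma homogeneous_expenditure:
  fixes f :: "real ^ 'k::finite \<Rightarrow> real"
  assumes u: "utility f" and p: "\<forall>i. p $ i > 0"
    and h: "homogeneous \<beta> f" "\<beta> > 0"
  obtains C where "C > 0"
    "\<And>t. t \<in> orthant \<Longrightarrow> expenditure f p (f t) = C * f t powr (1 / \<beta>)"
proof -
  have f: "continuous_on orthant f"
    and inc: "\<And>t t'. t \<in> orthant \<Longrightarrow> t' \<in> orthant \<Longrightarrow> \<forall>i. t' $ i > t $ i \<Longrightarrow> f t' > f t"
    using u by (auto simp: utility_def)
  have f0: "f 0 = 0" by (rule homogeneous_utility_zero[OF h])
  have scale: "f (r *\<^sub>R t) = r powr \<beta> * f t" if "t \<in> orthant" "r > 0" for t r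
    using h that by (simp add: homogeneous_def)
  have one: "(1 :: real ^ 'k) \<in> orthant" by (simp add: orthant_def)
  have f1: "f 1 > 0" using inc[OF zero_in_orthant one] f0 by simp
  \<comment> \<open>Chosen so that \<open>a\<close> times the all-ones bundle has utility exactly 1,
    which shows that level 1 can be reached.\<close>
  define a where "a = (1 / f 1) powr (1 / \<beta>)"
  define s where "s = a *\<^sub>R (1 :: real ^ 'k)"
  have "a > 0" "a powr \<beta> = 1 / f 1"
    unfolding a_def powr_powr using f1 h(2) by simp_all
  then have "s \<in> orthant" "1 \<le> f s"
    using f1 one by (simp_all add: s_def orthant_scaleR scale)
  then obtain m where m: "m \<in> orthant" "1 \<le> f m"
    and min: "\<And>s. s \<in> orthant \<Longrightarrow> 1 \<le> f s \<Longrightarrow> p \<bullet> m \<le> p \<bullet> s"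
    using expenditure_attained[OF f p, of s 1] by metis
  have "m \<noteq> 0" using m(2) f0 by auto
  then have pos: "p \<bullet> m > 0" using p m(1) by (intro inner_orthant_pos)
  have "expenditure f p (f t) = p \<bullet> m * f t powr (1 / \<beta>)" if t: "t \<in> orthant" for t
  proof (cases "f t = 0")
    case True
    have "expenditure f p 0 \<le> 0"
      using expenditure_le[OF f p zero_in_orthant, of 0] f0 by simp
    moreover obtain n where "n \<in> orthant" "expenditure f p 0 = p \<bullet> n"
      using expenditure_attained[OF f p zero_in_orthant, of 0] f0 by auto
    ultimately show ?thesis using True inner_orthant_nonneg[OF p] by force
  next
    case False
    with homogeneous_utility_nonneg[OF u h t] have ft: "f t > 0" by simp
    define c where "c = f t powr (1 / \<beta>)"
    have c: "c > 0" "c powr \<beta> = f t" using ft h(2) by (simp_all add: c_def powr_powr)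
    obtain n where n: "n \<in> orthant" "f t \<le> f n" "expenditure f p (f t) = p \<bullet> n"
      using expenditure_attained[OF f p t order_refl] by metis
    \<comment> \<open>Shrinking the minimizer \<open>n\<close> for level \<open>f t\<close> by
      \<open>c\<close> reaches level 1 and so costs at least as much as \<open>m\<close>.
      Conversely, \<open>m\<close> enlarged by \<open>c\<close> reaches level
      \<open>f t\<close>.\<close>
    have "inverse c powr \<beta> = inverse (f t)" using c by (simp add: inverse_powr)
    then have "f (inverse c *\<^sub>R n) = inverse (f t) * f n"
      using c(1) n(1) by (simp add: scale)
    then have "1 \<le> f (inverse c *\<^sub>R n)"
      using n(2) ft by (simp add: inverse_eq_divide pos_le_divide_eq)
    then have "p \<bullet> m \<le> p \<bullet> (inverse c *\<^sub>R n)"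
      using c n(1) by (intro min orthant_scaleR) auto
    then have "p \<bullet> m * c \<le> p \<bullet> n" using c(1) by (simp add: field_simps)
    moreover have "f t \<le> f (c *\<^sub>R m)"
      using c ft m by (simp add: scale)
    then have "expenditure f p (f t) \<le> p \<bullet> (c *\<^sub>R m)"
      using c m(1) by (intro expenditure_le f p orthant_scaleR) auto
    ultimately show ?thesis using n(3) by (simp add: c_def mult.commute)
  qed
  with pos show ?thesis by (rule that)
qed

section \<open>Feasible plans\<close>

lemma column_in_orthant: "q \<in> plans \<Longrightarrow> column j q \<in> orthant"
  by (simp add: plans_def orthant_def column_def)

lemma column_segment:
  "column j (a *\<^sub>R q + b *\<^sub>R r) = a *\<^sub>R column j q + b *\<^sub>R column j (r :: real ^ 'l ^ 'k)"
  by (simp add: column_def vec_eq_iff)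

lemma continuous_on_column: "continuous_on A (\<lambda>q :: real ^ 'l::finite ^ 'k::finite. column j q)"
  unfolding column_def by (intro continuous_intros)

lemma compact_plans: "compact (plans :: (real ^ 'l::finite ^ 'k::finite) set)"
proof -
  have "norm q \<le> 1" if "q \<in> plans" for q :: "real ^ 'l ^ 'k"
  proof -
    have "norm q \<le> (\<Sum>i\<in>UNIV. norm (q $ i))"
      unfolding norm_vec_def by (rule L2_set_le_sum) simp
    also have "\<dots> \<le> (\<Sum>i\<in>UNIV. \<Sum>j\<in>UNIV. \<bar>q $ i $ j\<bar>)"
      by (intro sum_mono norm_le_l1_cart)
    also have "\<dots> = 1" using that by (simp add: plans_def)
    finally show ?thesis .
  qed
  then have "bounded (plans :: (real ^ 'l ^ 'k) set)" by (auto simp: bounded_iff)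
  moreover have "closed (plans :: (real ^ 'l ^ 'k) set)"
    unfolding plans_def
    by (intro closed_Collect_conj closed_Collect_all closed_Collect_le closed_Collect_eq continuous_intros)
  ultimately show ?thesis by (simp add: compact_eq_bounded_closed)
qed

text \<open>The premises of the implications do not involve the plan, so their truth sets are open
  and each implication defines a closed set.\<close>

lemma closed_compatible: "closed {q :: real ^ 'l::finite ^ 'k::finite. compatible x y G q}"
  unfolding compatible_def case_prod_unfold Ball_def
  by (intro closed_Collect_conj closed_Collect_all closed_Collect_imp open_Collect_const
      closed_Collect_eq continuous_intros)

lemma continuous_on_utility_column:
  fixes u :: "'l::finite \<Rightarrow> real ^ 'k::finite \<Rightarrow> real"
  assumes "utility (u j)"
  shows "continuous_on plans (\<lambda>q. u j (column j q))"
  using assms unfolding utility_def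
  by (auto intro!: continuous_on_compose2[of orthant "u j"] continuous_on_column column_in_orthant)

lemma compact_feasible_plans:
  fixes u :: "'l::finite \<Rightarrow> real ^ 'k::finite \<Rightarrow> real"
  assumes u: "\<forall>j. utility (u j)"
  shows "compact (feasible_plans x y u qbar G)"
proof -
  \<comment> \<open>The superlevel set is taken inside \<open>plans\<close> because the utilities
    are only known to be continuous on the orthant.\<close>
  have "closed {q \<in> plans. u j (column j qbar) \<le> u j (column j q)}" for j
    using u compact_imp_closed[OF compact_plans]
    by (intro continuous_on_closed_Collect_le continuous_on_utility_column continuous_intros) auto
  then have "compact (plans \<inter> ({q. compatible x y G q} \<inter>
      (\<Inter>j. {q \<in> plans. u j (column j qbar) \<le> u j (column j q)})))"
    by (intro compact_Int_closed compact_plans closed_Int closed_compatible closed_INT) auto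
  also have "plans \<inter> ({q. compatible x y G q} \<inter>
      (\<Inter>j. {q \<in> plans. u j (column j qbar) \<le> u j (column j q)})) = feasible_plans x y u qbar G"
    by (auto simp: feasible_plans_def)
  finally show ?thesis .
qed

lemma continuous_on_S_total:
  fixes u :: "'l::finite \<Rightarrow> real ^ 'k::finite \<Rightarrow> real"
  assumes "\<forall>j. utility (u j)" "\<forall>j i. p j $ i > 0"
  shows "continuous_on plans (S_total u p)"
  unfolding S_total_def using assms
  by (auto intro!: continuous_on_sum continuous_on_compose2[OF continuous_on_expenditure_utility]
      continuous_on_column column_in_orthant)

section \<open>Convexity of the feasible set and concavity of the objective\<close>

lemma convex_plans: "convex (plans :: (real ^ 'l::finite ^ 'k::finite) set)"
  by (auto simp: convex_def plans_def sum.distrib simp flip: sum_distrib_left)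

lemma convex_compatible: "convex {q :: real ^ 'l::finite ^ 'k::finite. compatible x y G q}"
proof (rule convexI)
  fix q r :: "real ^ 'l ^ 'k" and a b :: real
  assume q: "q \<in> {q. compatible x y G q}" and r: "r \<in> {q. compatible x y G q}"
    and ab: "0 \<le> a" "0 \<le> b" "a + b = 1"
  have "(\<Sum>(i, j) | edge_on_curve G e (x i) (y j). (a *\<^sub>R q + b *\<^sub>R r) $ i $ j) = weight G e"
    if "e \<in> parcs (network G)" for e
  proof -
    have "(\<Sum>(i, j) | edge_on_curve G e (x i) (y j). (a *\<^sub>R q + b *\<^sub>R r) $ i $ j)
        = a * weight G e + b * weight G e"
      using q r that
      by (auto simp: compatible_def case_prod_unfold sum.distrib simp flip: sum_distrib_left)
    also have "\<dots> = weight G e" using ab by (simp flip: distrib_right)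
    finally show ?thesis .
  qed
  moreover have "(a *\<^sub>R q + b *\<^sub>R r) $ i $ j = 0" if "curves G (x i) (y j) = {}" for i j
    using q r that by (simp add: compatible_def)
  ultimately show "a *\<^sub>R q + b *\<^sub>R r \<in> {q. compatible x y G q}"
    unfolding compatible_def by blast
qed

lemma convex_feasible_plans:
  fixes u :: "'l::finite \<Rightarrow> real ^ 'k::finite \<Rightarrow> real"
  assumes u: "\<forall>j. utility (u j)"
  shows "convex (feasible_plans x y u qbar G)"
proof (rule convexI)
  fix q r :: "real ^ 'l ^ 'k" and a b :: real
  assume q: "q \<in> feasible_plans x y u qbar G" and r: "r \<in> feasible_plans x y u qbar G"
    and ab: "0 \<le> a" "0 \<le> b" "a + b = 1"
  let ?z = "a *\<^sub>R q + b *\<^sub>R r"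
  have "?z \<in> plans" "compatible x y G ?z"
    using q r ab convexD[OF convex_plans, of q r] convexD[OF convex_compatible[of x y G], of q r]
    by (auto simp: feasible_plans_def)
  moreover have "u j (column j qbar) \<le> u j (column j ?z)" for j
  proof -
    have "u j (column j qbar) = a * u j (column j qbar) + b * u j (column j qbar)"
      using ab by (simp flip: distrib_right)
    also have "\<dots> \<le> a * u j (column j q) + b * u j (column j r)"
      using q r ab by (intro add_mono mult_left_mono) (auto simp: feasible_plans_def)
    also have "\<dots> \<le> u j (column j ?z)"
      unfolding column_segment using u q r ab
      by (auto simp: utility_def concave_on_iff feasible_plans_def column_in_orthant)
    finally show ?thesis .
  qed
  ultimately show "?z \<in> feasible_plans x y u qbar G" by (simp add: feasible_plans_def)
qed

text \<open>By the explicit formula each summand is a positive constant times the root of a utility,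
  which is concave by assumption, composed with the linear column map.\<close>

lemma concave_on_S_total:
  fixes u :: "'l::finite \<Rightarrow> real ^ 'k::finite \<Rightarrow> real"
  assumes u: "\<forall>j. utility (u j)" and p: "\<forall>j i. p j $ i > 0"
    and h: "\<forall>j. homogeneous_root_concave (\<beta> j) (u j)"
  shows "concave_on plans (S_total u p)"
  unfolding concave_on_iff
proof (intro conjI convex_plans ballI allI impI)
  fix q r :: "real ^ 'l ^ 'k" and a b :: real
  assume qr: "q \<in> plans" "r \<in> plans" and ab: "0 \<le> a" "0 \<le> b" "a + b = 1"
  let ?z = "a *\<^sub>R q + b *\<^sub>R r" and ?e = "\<lambda>q j. expenditure (u j) (p j) (u j (column j q))"
  have z: "?z \<in> plans" using qr ab convex_plans by (auto simp: convex_def)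
  have "a * ?e q j + b * ?e r j \<le> ?e ?z j" for j
  proof -
    obtain C where C: "C > 0"
      "\<And>t. t \<in> orthant \<Longrightarrow> expenditure (u j) (p j) (u j t) = C * u j t powr (1 / \<beta> j)"
      using homogeneous_expenditure[of "u j" "p j" "\<beta> j"] u p h
      unfolding homogeneous_root_concave_def by metis
    have "a * u j (column j q) powr (1 / \<beta> j) + b * u j (column j r) powr (1 / \<beta> j)
        \<le> u j (column j ?z) powr (1 / \<beta> j)"
      unfolding column_segment using h qr ab
      by (auto simp: homogeneous_root_concave_def concave_on_iff column_in_orthant)
    then have "C * (a * u j (column j q) powr (1 / \<beta> j) + b * u j (column j r) powr (1 / \<beta> j))
        \<le> C * u j (column j ?z) powr (1 / \<beta> j)"
      using C(1) by (intro mult_left_mono) auto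
    then show ?thesis
      using C(2) qr z by (simp add: column_in_orthant algebra_simps)
  qed
  then show "a * S_total u p q + b * S_total u p r \<le> S_total u p ?z"
    unfolding S_total_def sum_distrib_left sum.distrib[symmetric] by (intro sum_mono)
qed

text \<open>Every summand satisfies the weak midpoint inequality, and column \<open>j0\<close>
  satisfies the strict one; this makes the finite sum strict.\<close>

lemma S_total_midpoint_less:
  fixes u :: "'l::finite \<Rightarrow> real ^ 'k::finite \<Rightarrow> real"
  assumes u: "\<forall>j. utility (u j)" and p: "\<forall>j i. p j $ i > 0"
    and h: "\<forall>j. homogeneous_root_concave (\<beta> j) (u j) \<and> root_strict_on_noncollinear (\<beta> j) (u j)"
    and qr: "q \<in> plans" "r \<in> plans"
    and j0: "\<not> collinear {0, column j0 q, column j0 r}"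
  shows "(S_total u p q + S_total u p r) / 2 < S_total u p ((1/2) *\<^sub>R q + (1/2) *\<^sub>R r)"
proof -
  let ?z = "(1/2) *\<^sub>R q + (1/2) *\<^sub>R r"
  let ?e = "\<lambda>q j. expenditure (u j) (p j) (u j (column j q))"
  have z: "?z \<in> plans" using qr convexD[OF convex_plans, of q r "1/2" "1/2"] by simp
  have e: "(?e q j + ?e r j) / 2 \<le> ?e ?z j"
    "\<not> collinear {0, column j q, column j r} \<Longrightarrow> (?e q j + ?e r j) / 2 < ?e ?z j" for j
  proof -
    obtain C where C: "C > 0"
      "\<And>t. t \<in> orthant \<Longrightarrow> expenditure (u j) (p j) (u j t) = C * u j t powr (1 / \<beta> j)"
      using homogeneous_expenditure[of "u j" "p j" "\<beta> j"] u p h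
      unfolding homogeneous_root_concave_def by metis
    let ?f = "\<lambda>q. u j (column j q) powr (1 / \<beta> j)"
    have orth: "column j q \<in> orthant" "column j r \<in> orthant" "column j ?z \<in> orthant"
      using qr z by (auto simp: column_in_orthant)
    have conc: "concave_on orthant (\<lambda>t. u j t powr (1 / \<beta> j))"
      using h by (simp add: homogeneous_root_concave_def)
    have "(?f q + ?f r) / 2 \<le> ?f ?z"
      using concave_onD[OF conc _ _ orth(1,2), of "1/2"] unfolding column_segment by simp
    then have "C * ((?f q + ?f r) / 2) \<le> C * ?f ?z"
      using C(1) by (intro mult_left_mono) auto
    then show "(?e q j + ?e r j) / 2 \<le> ?e ?z j"
      using C(2) orth by (simp add: algebra_simps)
    assume nc: "\<not> collinear {0, column j q, column j r}"
    have "root_strict_on_noncollinear (\<beta> j) (u j)" using h by simp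
    then have "(1 - 1/2) * ?f q + (1/2) * ?f r
        < u j ((1 - 1/2) *\<^sub>R column j q + (1/2) *\<^sub>R column j r) powr (1 / \<beta> j)"
      unfolding root_strict_on_noncollinear_def
      by (elim ballE[of _ _ "column j q"] ballE[of _ _ "column j r"] allE[of _ "1/2"])
        (use nc orth in auto)
    then have "(?f q + ?f r) / 2 < ?f ?z"
      unfolding column_segment by simp
    then have "C * ((?f q + ?f r) / 2) < C * ?f ?z"
      using C(1) by (intro mult_strict_left_mono) auto
    then show "(?e q j + ?e r j) / 2 < ?e ?z j"
      using C(2) orth by (simp add: algebra_simps)
  qed
  have "(\<Sum>j\<in>UNIV. (?e q j + ?e r j) / 2) < (\<Sum>j\<in>UNIV. ?e ?z j)"
    using e j0 by (intro sum_strict_mono_ex1) auto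
  then show ?thesis
    by (simp add: S_total_def sum.distrib flip: sum_divide_distrib)
qed

section \<open>Compactness, convexity and uniqueness of the solution set\<close>

theorem proposition3p6:
  fixes X :: "(real ^ 'm) set"
    and x :: "'k::finite \<Rightarrow> real ^ 'm"
    and y :: "'l::finite \<Rightarrow> real ^ 'm"
    and u :: "'l \<Rightarrow> real ^ 'k \<Rightarrow> real"
    and wealth :: "'l \<Rightarrow> real"
    and p :: "'l \<Rightarrow> real ^ 'k"
    and qbar :: "real ^ 'l ^ 'k"
    and G :: "(real ^ 'm) weighted_digraph"
    and \<beta> :: "'l \<Rightarrow> real"
  assumes "compact X" and "convex X"
    and "range x \<subseteq> X" and "range y \<subseteq> X"
    and "inj x" and "inj y" and "range x \<inter> range y = {}"
    and "\<forall>j. utility (u j)"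
    and "\<forall>j. wealth j > 0"
    and "\<forall>j i. p j $ i > 0"
    and "\<forall>j. is_arg_max (u j) (\<lambda>t. t \<in> budget_set (p j) (wealth j)) (column j qbar)"
    and "(\<Sum>i\<in>UNIV. \<Sum>j\<in>UNIV. qbar $ i $ j) = 1"
    and "\<forall>i. total_supply qbar i > 0" and "\<forall>j. total_demand qbar j > 0"
    and "G \<in> Omega X x y qbar"
  shows "(compact (solution_set x y u p qbar G) \<and> solution_set x y u p qbar G \<noteq> {}) \<and>
    ((\<forall>j. homogeneous_root_concave (\<beta> j) (u j)) \<longrightarrow>
        convex (solution_set x y u p qbar G)) \<and>
    ((\<forall>j. homogeneous_root_concave (\<beta> j) (u j) \<and> root_strict_on_noncollinear (\<beta> j) (u j)) \<longrightarrow>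
        is_singleton (solution_set x y u p qbar G) \<and>
        (\<exists>!q. is_arg_max (\<lambda>q. S_total u p q - S_total u p qbar)
                (\<lambda>q. q \<in> feasible_plans x y u qbar G) q))"
proof -
  let ?F = "feasible_plans x y u qbar G" and ?S = "S_total u p"
  have u: "\<forall>j. utility (u j)" and p: "\<forall>j i. p j $ i > 0" by fact+
  have G: "transport_path X x y (total_supply qbar) (total_demand qbar) G" "compatible x y G qbar"
    using \<open>G \<in> Omega X x y qbar\<close> by (auto simp: Omega_def)
  \<comment> \<open>Nonnegativity of \<open>qbar\<close> is not a separate assumption: it comes from
    its columns lying in the budget sets.\<close>
  have "column j qbar \<in> orthant" for j
    using assms(11) by (auto simp: is_arg_max_def budget_set_def)
  then have "qbar \<in> plans"
    using assms(12) by (simp add: plans_def orthant_def column_def)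
  then have ne: "?F \<noteq> {}" using G(2) by (auto simp: feasible_plans_def)
  have sub: "?F \<subseteq> plans" by (auto simp: feasible_plans_def)
  have cont: "continuous_on ?F ?S"
    using continuous_on_S_total[OF u p] sub by (rule continuous_on_subset)
  have cpt: "compact ?F" by (rule compact_feasible_plans[OF u])
  obtain qm where qm: "qm \<in> ?F" "\<forall>q\<in>?F. ?S q \<le> ?S qm"
    using continuous_attains_sup[OF cpt ne cont] by blast
  have "(GREATEST s. \<exists>q\<in>?F. s = ?S q) = ?S qm"
    using qm by (intro Greatest_equality) auto
  \<comment> \<open>As a superlevel set at the maximum, the solution set is closed by continuity
    and, under concavity, convex.\<close>
  then have sol: "solution_set x y u p qbar G = {q \<in> ?F. ?S qm \<le> ?S q}"
    using qm by (auto simp: solution_set_def exchange_value_def intro: antisym)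
  have "closed {q \<in> ?F. ?S qm \<le> ?S q}"
    using cont compact_imp_closed[OF cpt] by (intro continuous_on_closed_Collect_le continuous_intros)
  then have "compact (?F \<inter> {q \<in> ?F. ?S qm \<le> ?S q})"
    by (rule compact_Int_closed[OF cpt])
  then have 1: "compact (solution_set x y u p qbar G)"
    unfolding sol by (simp add: Int_def conj_ac)
  have ne_sol: "qm \<in> solution_set x y u p qbar G" using qm by (simp add: sol)
  have 2: "convex (solution_set x y u p qbar G)" if h: "\<forall>j. homogeneous_root_concave (\<beta> j) (u j)"
  proof (rule convexI)
    fix q r :: "real ^ 'l ^ 'k" and a b :: real
    assume qr: "q \<in> solution_set x y u p qbar G" "r \<in> solution_set x y u p qbar G"
      and ab: "0 \<le> a" "0 \<le> b" "a + b = 1"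
    have "?S qm = a * ?S qm + b * ?S qm" using ab by (simp flip: distrib_right)
    also have "\<dots> \<le> a * ?S q + b * ?S r"
      using qr ab by (intro add_mono mult_left_mono) (auto simp: sol)
    also have "\<dots> \<le> ?S (a *\<^sub>R q + b *\<^sub>R r)"
    proof -
      have "q \<in> plans" "r \<in> plans" using qr sub by (auto simp: sol)
      then show ?thesis
        using concave_on_S_total[OF u p h] ab unfolding concave_on_iff by blast
    qed
    finally show "a *\<^sub>R q + b *\<^sub>R r \<in> solution_set x y u p qbar G"
      using convexD[OF convex_feasible_plans[OF u], of q x y qbar G r] qr ab by (auto simp: sol)
  qed
  have 3: "q = r"
    if h: "\<forall>j. homogeneous_root_concave (\<beta> j) (u j) \<and> root_strict_on_noncollinear (\<beta> j) (u j)"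
      and qr: "q \<in> solution_set x y u p qbar G" "r \<in> solution_set x y u p qbar G" for q r
  proof -
    have F: "q \<in> ?F" "r \<in> ?F" "q \<in> plans" "r \<in> plans" using qr sub by (auto simp: sol)
    \<comment> \<open>Otherwise the midpoint, feasible by convexity, would exceed the maximal value
      \<open>?S qm\<close>.\<close>
    have col: "collinear {0, column j q, column j r}" for j
    proof (rule ccontr)
      assume "\<not> ?thesis"
      then have "(?S q + ?S r) / 2 < ?S ((1/2) *\<^sub>R q + (1/2) *\<^sub>R r)"
        by (rule S_total_midpoint_less[OF u p h F(3,4)])
      moreover have "(1/2) *\<^sub>R q + (1/2) *\<^sub>R r \<in> ?F"
        using convexD[OF convex_feasible_plans[OF u] F(1,2), of "1/2" "1/2"] by simp
      ultimately show False using qm(2) qr by (force simp: sol)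
    qed
    have dem: "total_demand s j = total_demand qbar j" if "s \<in> ?F" for s j
      using G that \<open>inj y\<close> \<open>range x \<inter> range y = {}\<close>
      by (intro compatible_total_demand_eq[of G x y]) (auto simp: transport_path_def feasible_plans_def)
    have demand_column: "total_demand s j = (\<Sum>i\<in>UNIV. column j s $ i)" for s :: "real ^ 'l ^ 'k" and j
      by (simp add: total_demand_def column_def)
    have "column j q = column j r" for j
    proof -
      have sums: "(\<Sum>i\<in>UNIV. column j q $ i) = total_demand qbar j"
        "(\<Sum>i\<in>UNIV. column j r $ i) = total_demand qbar j"
        using dem[OF F(1)] dem[OF F(2)] by (simp_all add: demand_column)
      have pos: "total_demand qbar j > 0" using assms(14) by simp
      then have "column j q \<noteq> 0" "column j r \<noteq> 0" using sums by auto
      \<comment> \<open>With both columns nonzero, collinearity with the origin leaves only this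
        alternative. Comparing entry sums, which both equal the positive demand, then forces
        \<open>c\<close> to be 1.\<close>
      then obtain c where c: "column j r = c *\<^sub>R column j q"
        using col[of j] by (auto simp: collinear_lemma)
      then have "c * total_demand qbar j = total_demand qbar j"
        using sums by (simp flip: sum_distrib_left)
      then show ?thesis using c pos by simp
    qed
    then show ?thesis by (simp add: column_def vec_eq_iff)
  qed
  \<comment> \<open>Subtracting the constant \<open>?S qbar\<close> does not change the maximizers,
    so unique solvability is the singleton property restated.\<close>
  have arg_max: "is_arg_max (\<lambda>q. ?S q - ?S qbar) (\<lambda>q. q \<in> ?F) q
      \<longleftrightarrow> q \<in> solution_set x y u p qbar G" for q
    using qm by (force simp: is_arg_max_def sol)
  show ?thesis
    unfolding arg_max using 1 2 3 ne_sol by (auto simp: is_singleton_def)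
qed

end
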